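(* Let $n\ge 1$, let $\mathfrak{d}$ be a delta operator on $\mathbb{C}_n[t]$, and let $\eta=(S_k)_{0\le k\le n}$ be the associated binomial curve. Then: (i) For all $a,b\in\{0,\dots,n\}$, $\langle S_a, S_b^{\dagger}\rangle_n^{\mathfrak{d}} = a!\,b!\,\delta_{a+b,n}$. (ii) If $\theta=(P_k)_{0\le k\le n}$ is a Vandermonde curve and $\theta^*=(Q_k)_{0\le k\le n}$ is its $\mathfrak{d}$-dual curve, then for all $a,b\in\{0,\dots,n\}$, $\langle P_a, Q_b^{\dagger}\rangle_n^{\mathfrak{d}}=a!\,b!\,\delta_{a+b,n}$. (iii) The binomial curve $\eta$ is self-dual: $\eta^*=\eta$. (iv) If $\theta$ is a Sheffer curve attached to $\eta$, written $\theta=u\star\eta$ with $u\in\mathbb{C}^{n+1}$, $u_0\ne 0$, then $\theta^*$ is its inverse for binomial convolution, i.e. $\theta^*=u^{-1}\star\eta$ where $u^{-1}$ is the inverse of $u$ for $\star$; moreover $n!\,W_{\theta}^{\mathfrak{d}}(t,\eta(s))=\theta_n^*(t+s)$ for all $s,t\in\mathbb{C}$, where $\theta^*_n$ is the last (index $n$) component of $\theta^*$.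
   Context: $\mathbb{C}_n[t]$ is the space of complex polynomials of degree at most $n$. A delta operator on $\mathbb{C}_n[t]$ is a linear endomorphism $\mathfrak{d}$ commuting with all translations $P(t)\mapsto P(t+a)$, with $\mathfrak{d}(1)=0$ and $\mathfrak{d}(t)\neq 0$; equivalently $\mathfrak{d}=\sum_{k=1}^n a_k\,\partial^k/\partial t^k$ with $a_1\ne0$. Its binomial curve is $\eta=(S_k)_{0\le k\le n}$, the unique family with $\deg S_k=k$, $S_0=1$, and $\mathfrak{d}S_k=kS_{k-1}$, $S_k(0)=0$ for $1\le k\le n$. A Vandermonde curve is a map $\theta:\mathbb{C}\to\mathbb{C}^{n+1}$, $\theta(t)=(P_0(t),\dots,P_n(t))^{\top}$, with each $P_k$ a polynomial of degree exactly $k$. It is a Sheffer curve attached to $\eta$ if $\mathfrak{d}P_0=0$ and $\mathfrak{d}P_k=kP_{k-1}$ for $1\le k\le n$. Binomial convolution of $a,b$ (indexed by $0,\dots,n$, with entries in a commutative $\mathbb{Q}$-algebra) is $(a\star b)_m=\sum_{k=0}^m\binom{m}{k}a_k b_{m-k}$; its unit is $e_0=(1,0,\dots,0)$, and $a$ is invertible iff $a_0$ is. The Sheffer curves attached to $\eta$ are exactly the curves $u\star\eta(t)$ with $u\in\mathbb{C}^{n+1}$, $u_0\ne0$, and are identified in this way with the invertible elements of $(\mathbb{C}^{n+1},\star)$. Notation: $P^{\dagger}(t)=P(-t)$; $\mathfrak{d}^*P=-(\mathfrak{d}(P^{\dagger}))^{\dagger}$. The umbral polarity pairing is $\langle A,B\rangle_n^{\mathfrak{d}}=\sum_{p=0}^n(-1)^{n-p}\,\mathfrak{d}^pA\cdot(\mathfrak{d}^*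 )^{n-p}B$ for $A,B\in\mathbb{C}_n[t]$ (it is a constant polynomial, viewed as a number). The umbral Wronskian of a Vandermonde curve $\theta$ is, for $v\in\mathbb{C}^{n+1}$, $$W_\theta^{\mathfrak{d}}(-t,v)=\frac{\det(\theta(t),\mathfrak{d}\theta(t),\dots,\mathfrak{d}^{n-1}\theta(t),v)}{\det(\theta(t),\mathfrak{d}\theta(t),\dots,\mathfrak{d}^{n-1}\theta(t),\mathfrak{d}^n\theta(t))},$$ where $\mathfrak{d}$ acts componentwise (the denominator is a nonzero constant). With $e_0,\dots,e_n$ the standard basis of $\mathbb{C}^{n+1}$, the $\mathfrak{d}$-dual curve $\theta^*=(Q_k)_{0\le k\le n}$ is defined by $Q_k(t)=k!\,(n-k)!\,W^{\mathfrak{d}}_\theta(t,e_{n-k})$. *)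

theory Defs
  imports
    "HOL-Computational_Algebra.Polynomial"
    "Jordan_Normal_Form.Determinant"
begin

text \<open>
  The space of complex polynomials of degree at most \<open>n\<close> is represented by the polynomials
  \<open>p :: complex poly\<close> with \<open>degree p \<le> n\<close>.  An operator on it is a function on all of
  \<open>complex poly\<close> whose values at polynomials of degree greater than \<open>n\<close> are irrelevant.
\<close>

definition delta_operator :: "nat \<Rightarrow> (complex poly \<Rightarrow> complex poly) \<Rightarrow> bool" where
  "delta_operator n d \<longleftrightarrow>
     (\<forall>p. degree p \<le> n \<longrightarrow> degree (d p) \<le> n) \<and>
     (\<forall>p q. degree p \<le> n \<longrightarrow> degree q \<le> n \<longrightarrow> d (p + q) = d p + d q) \<and>
     (\<forall>c p. degree p \<le> n \<longrightarrow> d (smult c p) = smult c (d p)) \<and>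
     (\<forall>a p. degree p \<le> n \<longrightarrow> d (p \<circ>\<^sub>p [:a, 1:]) = d p \<circ>\<^sub>p [:a, 1:]) \<and>
     d 1 = 0 \<and> d [:0, 1:] \<noteq> 0"

definition dagger :: "complex poly \<Rightarrow> complex poly" where
  "dagger p = p \<circ>\<^sub>p [:0, -1:]"

definition adjoint_op :: "(complex poly \<Rightarrow> complex poly) \<Rightarrow> complex poly \<Rightarrow> complex poly" where
  "adjoint_op d p = - dagger (d (dagger p))"

text \<open>
  The pairing is kept as a polynomial: saying that it has the value \<open>c\<close> means that it equals
  the constant polynomial \<open>[:c:]\<close>, which includes the assertion that it is constant.
\<close>

definition umbral_pairing ::
  "nat \<Rightarrow> (complex poly \<Rightarrow> complex poly) \<Rightarrow> complex poly \<Rightarrow> complex poly \<Rightarrow> complex poly" where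
  "umbral_pairing n d A B =
     (\<Sum>p\<le>n. (-1) ^ (n - p) * (d ^^ p) A * (adjoint_op d ^^ (n - p)) B)"

text \<open>
  A curve is the vector of its \<open>n + 1\<close> polynomial components, indexed from \<open>0\<close> to \<open>n\<close>.
  The condition \<open>\<theta> $ k \<noteq> 0\<close> only matters for \<open>k = 0\<close>: in the library \<open>degree 0 = 0\<close>,
  whereas the zero polynomial does not count as having degree exactly \<open>0\<close>.
\<close>

definition vandermonde_curve :: "nat \<Rightarrow> complex poly vec \<Rightarrow> bool" where
  "vandermonde_curve n \<theta> \<longleftrightarrow>
     \<theta> \<in> carrier_vec (n + 1) \<and> (\<forall>k\<le>n. \<theta> $ k \<noteq> 0 \<and> degree (\<theta> $ k) = k)"

definition binomial_curve ::
  "nat \<Rightarrow> (complex poly \<Rightarrow> complex poly) \<Rightarrow> complex poly vec \<Rightarrow> bool" where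
  "binomial_curve n d \<eta> \<longleftrightarrow>
     \<eta> \<in> carrier_vec (n + 1) \<and> (\<forall>k\<le>n. degree (\<eta> $ k) = k) \<and> \<eta> $ 0 = 1 \<and>
     (\<forall>k\<in>{1..n}. d (\<eta> $ k) = of_nat k * \<eta> $ (k - 1) \<and> poly (\<eta> $ k) 0 = 0)"

definition sheffer_curve ::
  "nat \<Rightarrow> (complex poly \<Rightarrow> complex poly) \<Rightarrow> complex poly vec \<Rightarrow> bool" where
  "sheffer_curve n d \<theta> \<longleftrightarrow>
     vandermonde_curve n \<theta> \<and> d (\<theta> $ 0) = 0 \<and>
     (\<forall>k\<in>{1..n}. d (\<theta> $ k) = of_nat k * \<theta> $ (k - 1))"

text \<open>Binomial convolution of two vectors of the same dimension.\<close>

definition bconv :: "'a::comm_ring_1 vec \<Rightarrow> 'a vec \<Rightarrow> 'a vec" (infixl "\<star>" 70) where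
  "a \<star> b = vec (dim_vec a) (\<lambda>m. \<Sum>k\<le>m. of_nat (m choose k) * a $ k * b $ (m - k))"

definition bconv_inverse :: "complex vec \<Rightarrow> complex vec" where
  "bconv_inverse u =
     (THE v. v \<in> carrier_vec (dim_vec u) \<and> u \<star> v = unit_vec (dim_vec u) 0)"

text \<open>Constant vectors, seen as vectors over \<open>complex poly\<close>, so that they can be convolved with curves.\<close>

definition const_curve :: "complex vec \<Rightarrow> complex poly vec" where
  "const_curve u = map_vec (\<lambda>c. [:c:]) u"

definition curve_at :: "complex poly vec \<Rightarrow> complex \<Rightarrow> complex vec" where
  "curve_at \<theta> t = map_vec (\<lambda>p. poly p t) \<theta>"

text \<open>
  The Wronskian \<open>W\<close> is specified through its value at \<open>-t\<close>; hence its value at \<open>t\<close> is a ratio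
  of determinants evaluated at \<open>-t\<close>, as the lemma below spells out.
\<close>

definition umbral_cols ::
  "(complex poly \<Rightarrow> complex poly) \<Rightarrow> complex poly vec \<Rightarrow> nat \<Rightarrow> complex \<Rightarrow> complex vec list" where
  "umbral_cols d \<theta> m t = map (\<lambda>j. curve_at (map_vec (d ^^ j) \<theta>) t) [0..<m]"

definition umbral_wronskian ::
  "nat \<Rightarrow> (complex poly \<Rightarrow> complex poly) \<Rightarrow> complex poly vec \<Rightarrow> complex \<Rightarrow> complex vec \<Rightarrow> complex"
where
  "umbral_wronskian n d \<theta> t v =
     det (mat_of_cols (n + 1) (umbral_cols d \<theta> n (-t) @ [v])) /
     det (mat_of_cols (n + 1) (umbral_cols d \<theta> (n + 1) (-t)))"

lemma umbral_wronskian_minus: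
  "umbral_wronskian n d \<theta> (-t) v =
     det (mat_of_cols (n + 1) (umbral_cols d \<theta> n t @ [v])) /
     det (mat_of_cols (n + 1) (umbral_cols d \<theta> n t @ [curve_at (map_vec (d ^^ n) \<theta>) t]))"
  by (simp add: umbral_wronskian_def umbral_cols_def)

text \<open>
  The components of the dual curve are specified by their values.  For a Vandermonde curve and a
  delta operator the denominator above does not depend on the point and is nonzero, so these values
  are those of a polynomial, which is unique since \<open>complex\<close> is infinite.
\<close>

definition dual_curve ::
  "nat \<Rightarrow> (complex poly \<Rightarrow> complex poly) \<Rightarrow> complex poly vec \<Rightarrow> complex poly vec" where
  "dual_curve n d \<theta> = vec (n + 1) (\<lambda>k. THE Q. \<forall>t.
     poly Q t = fact k * fact (n - k) * umbral_wronskian n d \<theta> t (unit_vec (n + 1) (n - k)))"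

end

theory Submission
  imports Defs "HOL-Computational_Algebra.Formal_Power_Series"
begin

text \<open>
  The identity \<open>\<eta>(s + t) = \<eta>(s) \<star> \<eta>(t)\<close> drives everything: since \<open>d\<^sup>j S\<^sub>k = j! (k choose j) S\<^sub>k\<^sub>-\<^sub>j\<close>, the
  pairing of \<open>S\<^sub>a\<close> with the reflected \<open>S\<^sub>b\<close> is a multiple of \<open>(\<eta>(t) \<star> \<eta>(-t))\<^sub>m\<close>, \<open>m = a + b - n\<close>.
  A Vandermonde curve is \<open>\<theta> = M \<eta>\<close> with a constant invertible matrix \<open>M\<close>.  The coordinates of
  \<open>M x\<close> in the basis \<open>\<theta>(t), d \<theta>(t), \<dots>\<close> are \<open>(x \<star> \<eta>(-t))\<^sub>j / j!\<close>, so by Cramer's rule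
  \<open>n! W\<^sub>\<theta>(t, M x) = (x \<star> \<eta>(t))\<^sub>n\<close>, and the dual curve is explicit in terms of \<open>M\<^sup>-\<^sup>1\<close>.  For a Sheffer
  curve \<open>M\<close> is convolution with \<open>u\<close>, and \<open>M\<^sup>-\<^sup>1\<close> is convolution with the inverse of \<open>u\<close>.
\<close>

section \<open>Binomial convolution of sequences and exponential generating functions\<close>

definition binconv :: "(nat \<Rightarrow> complex) \<Rightarrow> (nat \<Rightarrow> complex) \<Rightarrow> nat \<Rightarrow> complex" where
  "binconv a b m = (\<Sum>k\<le>m. of_nat (m choose k) * a k * b (m - k))"

text \<open>The exponential generating function turns convolution into the product of formal power
  series, so the laws of \<open>binconv\<close> are inherited from that ring. Sequences over all
  naturals keep these laws free of index bounds.\<close>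

definition egf :: "(nat \<Rightarrow> complex) \<Rightarrow> complex fps" where
  "egf a = Abs_fps (\<lambda>k. a k / fact k)"

lemma egf_inject: "egf a = egf b \<longleftrightarrow> a = b"
  by (auto simp: egf_def fps_eq_iff)

lemma binconv_div_fact:
  "binconv a b m / fact m = (\<Sum>k\<le>m. (a k / fact k) * (b (m - k) / fact (m - k)))"
  unfolding binconv_def sum_divide_distrib by (rule sum.cong) (auto simp: binomial_fact)

lemma egf_binconv: "egf (binconv a b) = egf a * egf b"
  by (rule fps_ext) (simp add: egf_def fps_mult_nth atMost_atLeast0 binconv_div_fact)

lemma binconv_commute: "binconv a b = binconv b a"
  by (simp add: egf_inject[symmetric] egf_binconv mult.commute)

lemma binconv_assoc: "binconv (binconv a b) c = binconv a (binconv b c)"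
  by (simp add: egf_inject[symmetric] egf_binconv mult.assoc)

lemma binconv_unit_left: "binconv (\<lambda>k. if k = 0 then 1 else 0) a = a"
proof -
  have "egf (\<lambda>k. if k = 0 then 1 else 0) = 1"
    by (rule fps_ext) (auto simp: egf_def)
  then show ?thesis
    by (simp add: egf_inject[symmetric] egf_binconv)
qed

lemma binconv_unit_right: "binconv a (\<lambda>k. if k = 0 then 1 else 0) = a"
  by (metis binconv_commute binconv_unit_left)

text \<open>An entry depends only on indices up to its own. Identities known only up to n can
  therefore be used inside sequences whose later values are arbitrary.\<close>

lemma binconv_cong:
  assumes "\<And>k. k \<le> m \<Longrightarrow> a k = a' k" "\<And>k. k \<le> m \<Longrightarrow> b k = b' k"
  shows "binconv a b m = binconv a' b' m"
  unfolding binconv_def using assms by (auto intro!: sum.cong)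

lemma binconv_flip: "binconv a b m = (\<Sum>k\<le>m. of_nat (m choose k) * b (m - k) * a k)"
  unfolding binconv_def by (auto intro!: sum.cong)

text \<open>This is column l of the matrix of convolution by \<open>a\<close>, written as a
  convolution itself, so that products of such matrices reduce to associativity.\<close>

lemma binconv_delta:
  "binconv (\<lambda>k. if k = l then 1 else 0) a m = of_nat (m choose l) * a (m - l)"
proof -
  have "binconv (\<lambda>k. if k = l then 1 else 0) a m
      = (\<Sum>k\<le>m. if k = l then of_nat (m choose l) * a (m - l) else 0)"
    unfolding binconv_def by (rule sum.cong) auto
  then show ?thesis
    by (auto simp: binomial_eq_0)
qed

text \<open>The constant term of \<open>egf a\<close> is nonzero, so the series is a unit; the
  coefficients of its inverse, rescaled by factorials, give \<open>b\<close>.\<close>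

lemma binconv_inverse_exists:
  assumes "a 0 \<noteq> 0"
  obtains b where "binconv a b = (\<lambda>k. if k = 0 then 1 else 0)"
proof
  define b where "b k = fact k * fps_nth (inverse (egf a)) k" for k
  have b: "egf b = inverse (egf a)"
    by (rule fps_ext) (simp add: egf_def b_def)
  have "fps_nth (egf a) 0 \<noteq> 0"
    using assms by (simp add: egf_def)
  then have "egf a * inverse (egf a) = 1"
    by (metis inverse_mult_eq_1 mult.commute)
  moreover have "egf (\<lambda>k. if k = 0 then 1 else 0) = 1"
    by (rule fps_ext) (auto simp: egf_def)
  ultimately show "binconv a b = (\<lambda>k. if k = 0 then 1 else 0)"
    by (simp add: egf_inject[symmetric] egf_binconv b)
qed

text \<open>Relates the inverse among vectors of length n + 1 to an inverse of the full sequence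
  \<open>($) u\<close>, whose entries beyond n are unspecified but never reach the entries up to
  n.\<close>

lemma bconv_inverse_eq:
  assumes u: "u \<in> carrier_vec (n + 1)"
    and w: "binconv (($) u) w = (\<lambda>k. if k = 0 then 1 else 0)"
  shows "bconv_inverse u = vec (n + 1) w"
proof -
  have conv: "u \<star> v = vec (n + 1) (binconv (($) u) (($) v))" for v
    using u by (auto simp: bconv_def binconv_def)
  have unit: "unit_vec (n + 1) 0 = vec (n + 1) (\<lambda>k. if k = 0 then 1 else 0 :: complex)"
    by (auto simp: unit_vec_def)
  show ?thesis
    unfolding bconv_inverse_def
  proof (rule the_equality)
    have "u \<star> vec (n + 1) w = vec (n + 1) (binconv (($) u) w)"
      unfolding conv by (intro eq_vecI) (auto intro!: binconv_cong)
    then show "vec (n + 1) w \<in> carrier_vec (dim_vec u)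
        \<and> u \<star> vec (n + 1) w = unit_vec (dim_vec u) 0"
      using u w unit by simp
  next
    fix v assume v: "v \<in> carrier_vec (dim_vec u) \<and> u \<star> v = unit_vec (dim_vec u) 0"
    then have conv_v: "vec (n + 1) (binconv (($) u) (($) v)) = vec (n + 1) (\<lambda>k. if k = 0 then 1 else 0)"
      using u conv unit by simp
    have uv: "binconv (($) u) (($) v) k = (if k = 0 then 1 else 0)" if "k \<le> n" for k
      using arg_cong[OF conv_v, of "\<lambda>x. x $ k"] that by (simp add: less_Suc_eq_le)
    \<comment> \<open>Uniqueness as in any monoid: v = (w \<star> u) \<star> v = w \<star> (u
      \<star> v) = w, where u \<star> v is known only up to index n.\<close>
    have "v $ m = w m" if "m \<le> n" for m
    proof -
      have "v $ m = binconv (binconv w (($) u)) (($) v) m"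
        unfolding binconv_commute[of w "($) u"] w binconv_unit_left ..
      also have "\<dots> = binconv w (\<lambda>k. if k = 0 then 1 else 0) m"
        unfolding binconv_assoc using that uv by (intro binconv_cong) auto
      finally show ?thesis by (simp add: binconv_unit_right)
    qed
    then show "v = vec (n + 1) w"
      using v u by (intro eq_vecI) auto
  qed
qed

section \<open>Families of polynomials with one member in each degree\<close>

lemma smult_sum_right: "smult c (\<Sum>i\<in>A. p i) = (\<Sum>i\<in>A. smult c (p i))"
  by (induction A rule: infinite_finite_induct) (simp_all add: smult_add_right)

text \<open>Elimination from the top: subtracting the multiple \<open>x\<close> of the last member
  that cancels the coefficient of \<open>p\<close> in degree \<open>Suc m\<close> leaves a
  polynomial of degree at most m.\<close>

lemma graded_family_spans:
  fixes P :: "nat \<Rightarrow> 'a::field poly"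
  assumes "\<And>k. k \<le> m \<Longrightarrow> degree (P k) = k \<and> P k \<noteq> 0" "degree p \<le> m"
  shows "\<exists>c. p = (\<Sum>k\<le>m. smult (c k) (P k))"
  using assms
proof (induction m arbitrary: p)
  case 0
  then have "degree (P 0) = 0" "P 0 \<noteq> 0" "degree p = 0" by auto
  then obtain x y where "P 0 = [:x:]" "x \<noteq> 0" "p = [:y:]"
    by (metis degree_eq_zeroE pCons_0_0)
  then have "p = (\<Sum>k\<le>0. smult (y / x) (P k))" by simp
  then show ?case by (rule exI[where x = "\<lambda>_. y / x"])
next
  case (Suc m)
  define x where "x = coeff p (Suc m) / coeff (P (Suc m)) (Suc m)"
  define q where "q = p - smult x (P (Suc m))"
  have P: "degree (P (Suc m)) = Suc m" "coeff (P (Suc m)) (Suc m) \<noteq> 0"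
    using Suc.prems(1)[of "Suc m"] by (auto simp: leading_coeff_neq_0 dest: leading_coeff_neq_0)
  have "coeff q i = 0" if "i > m" for i
  proof (cases "i = Suc m")
    case True
    then show ?thesis using P by (simp add: q_def x_def)
  next
    case False
    then show ?thesis using that P Suc.prems(2) by (simp add: q_def coeff_eq_0)
  qed
  then have "degree q \<le> m" by (meson degree_le)
  then obtain c where c: "q = (\<Sum>k\<le>m. smult (c k) (P k))"
    using Suc.IH[of q] Suc.prems(1) by auto
  have "p = q + smult x (P (Suc m))" by (simp add: q_def)
  also have "\<dots> = (\<Sum>k\<le>Suc m. smult ((c(Suc m := x)) k) (P k))"
    by (simp add: c)
  finally show ?case by blast
qed

text \<open>Only the last member contributes to the top coefficient, so its scalar vanishes and the
  relation shortens.\<close>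

lemma graded_family_independent:
  fixes P :: "nat \<Rightarrow> 'a::field poly"
  assumes "\<And>k. k \<le> m \<Longrightarrow> degree (P k) = k \<and> P k \<noteq> 0"
    and "(\<Sum>k\<le>m. smult (c k) (P k)) = 0" "k \<le> m"
  shows "c k = 0"
  using assms
proof (induction m arbitrary: k)
  case 0
  then show ?case by auto
next
  case (Suc m)
  have P: "degree (P (Suc m)) = Suc m" "P (Suc m) \<noteq> 0"
    using Suc.prems(1)[of "Suc m"] by auto
  then have nz: "coeff (P (Suc m)) (Suc m) \<noteq> 0"
    by (metis leading_coeff_neq_0)
  have "coeff (P k) (Suc m) = 0" if "k \<le> m" for k
    using that Suc.prems(1)[of k] by (intro coeff_eq_0) auto
  then have "coeff (\<Sum>k\<le>Suc m. smult (c k) (P k)) (Suc m) = c (Suc m) * coeff (P (Suc m)) (Suc m)"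
    by (simp add: coeff_sum)
  then have top: "c (Suc m) = 0"
    unfolding Suc.prems(2) using nz by simp
  then have "(\<Sum>k\<le>m. smult (c k) (P k)) = 0"
    using Suc.prems(2) by simp
  then show ?case
    using Suc top by (cases "k = Suc m") auto
qed

section \<open>Reflection, and Cramer's rule for the Wronskian\<close>

lemma dagger_dagger [simp]: "dagger (dagger p) = p"
  by (simp add: dagger_def pcompose_assoc[symmetric] pcompose_pCons)

lemma poly_dagger [simp]: "poly (dagger p) t = poly p (- t)"
  by (simp add: dagger_def poly_pcompose)

lemma dagger_minus: "dagger (- p) = - dagger p"
  by (simp add: dagger_def pcompose_uminus)

text \<open>The entries of \<open>c\<close> are the coordinates of \<open>v\<close> in the columns
  of \<open>D\<close>, and the Wronskian is Cramer's quotient for the last one. The argument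
  \<open>- t\<close> undoes the reflection built into \<open>umbral_wronskian\<close>.\<close>

lemma umbral_wronskian_cramer:
  assumes \<theta>: "\<theta> \<in> carrier_vec (n + 1)" and c: "c \<in> carrier_vec (n + 1)"
    and D: "D = mat (n + 1) (n + 1) (\<lambda>(i, j). poly ((d ^^ j) (\<theta> $ i)) t)"
    and v: "v = D *\<^sub>v c" and nz: "det D \<noteq> 0"
  shows "umbral_wronskian n d \<theta> (- t) v = c $ n"
proof -
  have carr: "D \<in> carrier_mat (n + 1) (n + 1)" by (simp add: D)
  have "mat_of_cols (n + 1) (umbral_cols d \<theta> (n + 1) t) = D"
    using \<theta> by (intro eq_matI)
      (auto simp: D umbral_cols_def mat_of_cols_def curve_at_def simp del: upt_Suc)
  moreover have "mat_of_cols (n + 1) (umbral_cols d \<theta> n t @ [v]) = replace_col D v n"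
    using \<theta> by (intro eq_matI)
      (auto simp: D umbral_cols_def mat_of_cols_def curve_at_def replace_col_def nth_append)
  moreover have "det (replace_col D v n) = c $ n * det D"
    unfolding v using carr c by (intro cramer_lemma_mat) auto
  ultimately show ?thesis
    using nz by (simp add: umbral_wronskian_def)
qed

section \<open>The delta operator in its binomial basis, and the addition formula\<close>

context
  fixes n :: nat and d :: "complex poly \<Rightarrow> complex poly" and \<eta> :: "complex poly vec"
  assumes n: "n \<ge> 1" and delta: "delta_operator n d" and binomial: "binomial_curve n d \<eta>"
begin

text \<open>The point of the binomial curve at t as a full sequence, ready for
  \<open>binconv\<close>; its entries beyond n are unspecified, hence the bounds in the facts about
  it.\<close>

definition \<sigma> :: "complex \<Rightarrow> nat \<Rightarrow> complex" where
  "\<sigma> t k = poly (\<eta> $ k) t"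

lemma degree_d: "degree p \<le> n \<Longrightarrow> degree (d p) \<le> n"
  using delta by (auto simp: delta_operator_def)

lemma d_add: "degree p \<le> n \<Longrightarrow> degree q \<le> n \<Longrightarrow> d (p + q) = d p + d q"
  using delta by (auto simp: delta_operator_def)

lemma d_smult: "degree p \<le> n \<Longrightarrow> d (smult c p) = smult c (d p)"
  using delta by (auto simp: delta_operator_def)

lemma d_shift: "degree p \<le> n \<Longrightarrow> d (p \<circ>\<^sub>p [:a, 1:]) = d p \<circ>\<^sub>p [:a, 1:]"
  using delta by (auto simp: delta_operator_def)

lemma d_one: "d 1 = 0"
  using delta by (auto simp: delta_operator_def)

lemma eta_carrier: "\<eta> \<in> carrier_vec (n + 1)"
  using binomial by (auto simp: binomial_curve_def)

lemma degree_eta: "k \<le> n \<Longrightarrow> degree (\<eta> $ k) = k"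
  using binomial by (auto simp: binomial_curve_def)

lemma eta_0: "\<eta> $ 0 = 1"
  using binomial by (auto simp: binomial_curve_def)

text \<open>The case k = 0 is included: \<open>d 1\<close> and the factor \<open>of_nat k\<close>
  are then both zero.\<close>

lemma d_eta: "k \<le> n \<Longrightarrow> d (\<eta> $ k) = smult (of_nat k) (\<eta> $ (k - 1))"
  using binomial d_one by (cases "k = 0") (auto simp: binomial_curve_def of_nat_poly)

lemma eta_at_0: "k \<le> n \<Longrightarrow> \<sigma> 0 k = (if k = 0 then 1 else 0)"
  using binomial by (auto simp: binomial_curve_def \<sigma>_def)

lemma eta_nonzero: "k \<le> n \<Longrightarrow> \<eta> $ k \<noteq> 0"
  using degree_eta[of k] eta_0 by (cases "k = 0") auto

lemma d_0: "d 0 = 0"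
  using d_smult[of 0 0] by simp

lemma d_diff: "degree p \<le> n \<Longrightarrow> degree q \<le> n \<Longrightarrow> d (p - q) = d p - d q"
  using d_add[of p "- q"] d_smult[of q "- 1"] by simp

lemma d_sum:
  assumes "\<And>k. k \<in> A \<Longrightarrow> degree (p k) \<le> n"
  shows "d (\<Sum>k\<in>A. smult (c k) (p k)) = (\<Sum>k\<in>A. smult (c k) (d (p k)))"
  using assms
proof (induction A rule: infinite_finite_induct)
  case (insert x F)
  have "degree (\<Sum>k\<in>F. smult (c k) (p k)) \<le> n"
    by (rule degree_sum_le) (use insert in \<open>auto intro: order.trans[OF degree_smult_le]\<close>)
  with insert show ?case
    by (simp add: d_add d_smult order.trans[OF degree_smult_le])
qed (auto simp: d_0)

lemma degree_funpow_d: "degree p \<le> n \<Longrightarrow> degree ((d ^^ j) p) \<le> n"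
  by (induction j) (auto simp: degree_d)

lemma funpow_d_sum:
  assumes "\<And>k. k \<in> A \<Longrightarrow> degree (p k) \<le> n"
  shows "(d ^^ j) (\<Sum>k\<in>A. smult (c k) (p k)) = (\<Sum>k\<in>A. smult (c k) ((d ^^ j) (p k)))"
  by (induction j) (simp_all add: d_sum degree_funpow_d assms)

text \<open>For j > k the binomial coefficient is zero, so the truncated index \<open>k - j\<close>
  does no harm.\<close>

lemma funpow_d_eta:
  "k \<le> n \<Longrightarrow> (d ^^ j) (\<eta> $ k) = smult (fact j * of_nat (k choose j)) (\<eta> $ (k - j))"
proof (induction j)
  case (Suc j)
  have coeff: "fact j * of_nat (k choose j) * of_nat (k - j)
      = (fact (Suc j) * of_nat (k choose Suc j) :: complex)"
  proof -
    have "(k choose j) * (k - j) = Suc j * (k choose Suc j)"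
      by (metis binomial_absorb_comp binomial_absorption mult.commute)
    then have "(of_nat (k choose j) * of_nat (k - j) :: complex)
        = of_nat (Suc j) * of_nat (k choose Suc j)"
      by (metis of_nat_mult)
    then show ?thesis
      by (simp add: algebra_simps)
  qed
  have "(d ^^ Suc j) (\<eta> $ k) = smult (fact j * of_nat (k choose j)) (d (\<eta> $ (k - j)))"
    using Suc by (simp add: d_smult degree_eta)
  also have "\<dots> = smult (fact j * of_nat (k choose j) * of_nat (k - j)) (\<eta> $ (k - Suc j))"
    using Suc.prems by (simp add: d_eta)
  finally show ?case
    unfolding coeff .
qed simp

lemma funpow_d_eta_sum:
  "(d ^^ j) (\<Sum>k\<le>n. smult (c k) (\<eta> $ k)) = (\<Sum>k\<le>n. smult (c k) ((d ^^ j) (\<eta> $ k)))"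
  by (rule funpow_d_sum) (simp add: degree_eta)

text \<open>In the basis of the S_k the operator lowers indices with nonzero factors k, so only the
  coefficient of S_0 can survive. Hence polynomials with the same image differ by a
  constant.\<close>

lemma kernel_d:
  assumes "degree p \<le> n" "d p = 0"
  shows "degree p = 0"
proof -
  obtain m where m: "n = Suc m" using n by (cases n) auto
  obtain c where c: "p = (\<Sum>k\<le>n. smult (c k) (\<eta> $ k))"
    using graded_family_spans[of n "($) \<eta>" p] degree_eta eta_nonzero assms by auto
  have "0 = d p" using assms by simp
  also have "\<dots> = (\<Sum>k\<le>n. smult (c k) (d (\<eta> $ k)))"
    unfolding c by (rule d_sum) (simp add: degree_eta)
  also have "\<dots> = (\<Sum>k\<le>Suc m. smult (c k * of_nat k) (\<eta> $ (k - 1)))"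
    unfolding m[symmetric] by (rule sum.cong) (auto simp: d_eta)
  also have "\<dots> = (\<Sum>k\<le>m. smult (c (Suc k) * of_nat (Suc k)) (\<eta> $ k))"
    by (subst sum.atMost_Suc_shift) simp
  finally have "c (Suc k) * of_nat (Suc k) = 0" if "k \<le> m" for k
    using graded_family_independent[of m "($) \<eta>" "\<lambda>k. c (Suc k) * of_nat (Suc k)" k]
      degree_eta eta_nonzero m that by auto
  then have "c (Suc k) = 0" if "k \<le> m" for k
    using that by (metis mult_eq_0_iff of_nat_eq_0_iff nat.distinct(1))
  then have "p = smult (c 0) (\<eta> $ 0)"
    unfolding c m by (subst sum.atMost_Suc_shift) simp
  then show ?thesis by (simp add: eta_0)
qed

text \<open>Induction on m: by translation invariance and the induction hypothesis, both sides have
  the same image under \<open>d\<close>. They differ by a constant, and they agree at 0.\<close>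

lemma eta_shift:
  assumes "m \<le> n"
  shows "\<eta> $ m \<circ>\<^sub>p [:s, 1:] = (\<Sum>k\<le>m. smult (of_nat (m choose k) * \<sigma> s k) (\<eta> $ (m - k)))"
  using assms
proof (induction m)
  case 0
  then show ?case by (simp add: eta_0 \<sigma>_def pcompose_1)
next
  case (Suc m)
  let ?R = "\<Sum>k\<le>Suc m. smult (of_nat (Suc m choose k) * \<sigma> s k) (\<eta> $ (Suc m - k))"
  let ?L = "\<eta> $ Suc m \<circ>\<^sub>p [:s, 1:]"
  have "d ?R = (\<Sum>k\<le>Suc m. smult (of_nat (Suc m choose k) * \<sigma> s k) (d (\<eta> $ (Suc m - k))))"
    using Suc.prems by (intro d_sum) (simp add: degree_eta)
  \<comment> \<open>The last summand is a multiple of S_0 = 1, which \<open>d\<close> kills.\<close>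
  also have "\<dots> = (\<Sum>k\<le>m. smult (of_nat (Suc m choose k) * \<sigma> s k) (d (\<eta> $ (Suc m - k))))"
    by (simp add: eta_0 d_one)
  also have "\<dots> = (\<Sum>k\<le>m. smult (of_nat (Suc m)) (smult (of_nat (m choose k) * \<sigma> s k) (\<eta> $ (m - k))))"
  proof (rule sum.cong[OF refl])
    fix k assume k: "k \<in> {..m}"
    have "(Suc m choose k) * (Suc m - k) = Suc m * (m choose k)"
      using k binomial_absorb_comp[of "Suc m" k] by (simp add: mult.commute)
    then have *: "(of_nat (Suc m choose k) * of_nat (Suc m - k) :: complex)
        = of_nat (Suc m) * of_nat (m choose k)"
      by (metis of_nat_mult)
    have "d (\<eta> $ (Suc m - k)) = smult (of_nat (Suc m - k)) (\<eta> $ (m - k))"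
      using Suc.prems k by (subst d_eta) auto
    moreover have "of_nat (Suc m choose k) * \<sigma> s k * of_nat (Suc m - k)
        = of_nat (Suc m) * (of_nat (m choose k) * \<sigma> s k)"
      using * by (metis mult.assoc mult.commute)
    ultimately show "smult (of_nat (Suc m choose k) * \<sigma> s k) (d (\<eta> $ (Suc m - k)))
        = smult (of_nat (Suc m)) (smult (of_nat (m choose k) * \<sigma> s k) (\<eta> $ (m - k)))"
      by (simp only: smult_smult)
  qed
  also have "\<dots> = smult (of_nat (Suc m)) (\<eta> $ m \<circ>\<^sub>p [:s, 1:])"
    using Suc by (simp only: smult_sum_right Suc_leD)
  also have "\<dots> = d ?L"
    using Suc.prems by (simp add: d_shift degree_eta d_eta pcompose_smult del: of_nat_Suc)
  finally have dLR: "d ?R = d ?L" .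
  have degR: "degree ?R \<le> n"
    by (rule degree_sum_le)
      (use Suc.prems in \<open>auto simp: degree_eta intro!: order.trans[OF degree_smult_le]\<close>)
  have degL: "degree ?L \<le> n"
    using Suc.prems by (simp add: degree_pcompose degree_eta)
  have "d (?L - ?R) = 0"
    unfolding d_diff[OF degL degR] dLR by simp
  then have "degree (?L - ?R) = 0"
    using kernel_d degree_diff_le[OF degL degR] by blast
  then obtain x where x: "?L - ?R = [:x:]"
    by (rule degree_eq_zeroE)
  \<comment> \<open>At 0 every S_j with j > 0 vanishes, which leaves only the term k =
    \<open>Suc m\<close>.\<close>
  have "poly ?R 0 = (\<Sum>k\<le>Suc m. if k = Suc m then \<sigma> s (Suc m) else 0)"
    unfolding poly_sum
  proof (rule sum.cong[OF refl])
    fix k assume "k \<in> {..Suc m}"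
    then show "poly (smult (of_nat (Suc m choose k) * \<sigma> s k) (\<eta> $ (Suc m - k))) 0
        = (if k = Suc m then \<sigma> s (Suc m) else 0)"
      using eta_at_0[of "Suc m - k"] Suc.prems by (auto simp: \<sigma>_def)
  qed
  then have "poly (?L - ?R) 0 = 0"
    by (simp only: poly_diff poly_pcompose) (simp add: \<sigma>_def)
  then have "?L - ?R = 0"
    unfolding x by simp
  then show ?case by simp
qed

lemma binconv_eta: "m \<le> n \<Longrightarrow> binconv (\<sigma> s) (\<sigma> t) m = \<sigma> (s + t) m"
  using arg_cong[OF eta_shift[of m s], of "\<lambda>p. poly p t"]
  by (simp add: poly_pcompose poly_sum \<sigma>_def binconv_def add.commute)

lemma binconv_eta_minus:
  "m \<le> n \<Longrightarrow> binconv (\<sigma> t) (\<sigma> (- t)) m = (if m = 0 then 1 else 0)"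
  by (simp add: binconv_eta eta_at_0)

section \<open>The umbral pairing on the binomial basis and on linear combinations of it\<close>

lemma poly_umbral_pairing_dagger:
  assumes "degree B \<le> n"
  shows "poly (umbral_pairing n d A (dagger B)) t
    = (\<Sum>p\<le>n. poly ((d ^^ p) A) t * poly ((d ^^ (n - p)) B) (- t))"
proof -
  \<comment> \<open>Each adjoint step contributes a sign once the reflections cancel; these signs
    square away against the factor in the pairing.\<close>
  have adj: "(adjoint_op d ^^ q) (dagger B) = (-1) ^ q * dagger ((d ^^ q) B)" for q
  proof (induction q)
    case (Suc q)
    have "(-1) ^ q * dagger ((d ^^ q) B) = dagger (smult ((-1) ^ q) ((d ^^ q) B))"
      by (cases "even q") (auto simp: dagger_minus)
    then have "adjoint_op d ((-1) ^ q * dagger ((d ^^ q) B))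
        = - dagger (smult ((-1) ^ q) (d ((d ^^ q) B)))"
      using assms by (simp add: adjoint_op_def d_smult degree_funpow_d)
    also have "\<dots> = (-1) ^ Suc q * dagger ((d ^^ Suc q) B)"
      by (cases "even q") (auto simp: dagger_minus)
    finally show ?case using Suc by simp
  qed simp
  show ?thesis
    unfolding umbral_pairing_def poly_sum
    by (rule sum.cong[OF refl]) (simp add: adj poly_power power_add[symmetric] flip: mult.assoc)
qed

text \<open>If a + b < n, every p has p > a or n - p > b, so each term contains a zero binomial.
  Otherwise, with m = a + b - n, the sum is a! b! / m! times entry m of \<eta>(-t) \<star>
  \<eta>(t), which is \<eta>(0).\<close>

lemma poly_umbral_pairing_eta:
  assumes a: "a \<le> n" and b: "b \<le> n"
  shows "poly (umbral_pairing n d (\<eta> $ a) (dagger (\<eta> $ b))) t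
    = (if a + b = n then fact a * fact b else 0)"
proof -
  let ?f = "\<lambda>p. fact p * of_nat (a choose p) * \<sigma> t (a - p) *
     (fact (n - p) * of_nat (b choose (n - p)) * \<sigma> (- t) (b - (n - p)))"
  have eq: "poly (umbral_pairing n d (\<eta> $ a) (dagger (\<eta> $ b))) t = sum ?f {..n}"
    using a b by (simp add: poly_umbral_pairing_dagger degree_eta funpow_d_eta \<sigma>_def)
  show ?thesis
  proof (cases "a + b < n")
    case True
    have "?f p = 0" if "p \<in> {..n}" for p
    proof (cases "p > a")
      case False
      with True that have "n - p > b" by auto
      then show ?thesis by simp
    qed simp
    then show ?thesis using eq True by (simp add: sum.neutral)
  next
    case False
    obtain q where n_eq: "n = b + q"
      using b le_Suc_ex by blast
    have "q \<le> a"
      using False n_eq by simp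
    then obtain m where a_eq: "a = m + q"
      using le_Suc_ex add.commute by metis
    have mb: "m \<le> b"
      using a n_eq a_eq by simp
    have summand: "?f (i + q) = fact a * fact b * (\<sigma> (- t) i / fact i * (\<sigma> t (m - i) / fact (m - i)))"
      if i: "i \<le> m" for i
    proof -
      have diffs: "a - (i + q) = m - i" "n - (i + q) = b - i" "b - (b - i) = i"
        using i mb by (simp_all add: n_eq a_eq)
      have "fact (i + q) * of_nat (a choose (i + q)) = (fact a / fact (m - i) :: complex)"
        using i by (simp add: binomial_fact a_eq)
      moreover have "fact (b - i) * of_nat (b choose (b - i)) = (fact b / fact i :: complex)"
        using i mb by (simp add: binomial_fact)
      ultimately show ?thesis
        unfolding diffs by (simp add: mult_ac)
    qed
    \<comment> \<open>For p < q the second binomial vanishes because n - p > b; for p > m + q = a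
      the first one does.\<close>
    have "sum ?f {..n} = sum ?f {0 + q..m + q}"
      by (rule sum.mono_neutral_right) (auto simp: n_eq a_eq mb not_le)
    also have "\<dots> = (\<Sum>i\<le>m. ?f (i + q))"
      by (simp only: sum.shift_bounds_cl_nat_ivl atMost_atLeast0)
    also have "\<dots> = fact a * fact b * (binconv (\<sigma> (- t)) (\<sigma> t) m / fact m)"
      unfolding binconv_div_fact sum_distrib_left by (rule sum.cong) (simp_all only: summand atMost_iff)
    also have "\<dots> = (if a + b = n then fact a * fact b else 0)"
      using mb n_eq by (simp add: binconv_eta eta_at_0 a_eq)
    finally show ?thesis using eq by simp
  qed
qed

lemma umbral_pairing_eta:
  "a \<le> n \<Longrightarrow> b \<le> n \<Longrightarrow> umbral_pairing n d (\<eta> $ a) (dagger (\<eta> $ b))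
    = [:if a + b = n then fact a * fact b else 0:]"
  by (simp add: poly_umbral_pairing_eta fun_eq_iff flip: poly_eq_poly_eq_iff)

text \<open>Bilinearity, with the sum over p moved innermost: the pairing matrix of the binomial
  basis is antidiagonal, so only k = n - j remains.\<close>

lemma poly_umbral_pairing_sums:
  assumes A: "A = (\<Sum>j\<le>n. smult (\<alpha> j) (\<eta> $ j))" and B: "B = (\<Sum>k\<le>n. smult (\<beta> k) (\<eta> $ k))"
  shows "poly (umbral_pairing n d A (dagger B)) t
    = (\<Sum>j\<le>n. \<alpha> j * \<beta> (n - j) * fact j * fact (n - j))"
proof -
  have "degree B \<le> n"
    unfolding B by (rule degree_sum_le) (auto simp: degree_eta intro!: order.trans[OF degree_smult_le])
  then have "poly (umbral_pairing n d A (dagger B)) t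
      = (\<Sum>p\<le>n. (\<Sum>j\<le>n. \<alpha> j * poly ((d ^^ p) (\<eta> $ j)) t) *
           (\<Sum>k\<le>n. \<beta> k * poly ((d ^^ (n - p)) (\<eta> $ k)) (- t)))"
    by (simp add: poly_umbral_pairing_dagger A B funpow_d_eta_sum degree_eta poly_sum)
  also have "\<dots> = (\<Sum>p\<le>n. \<Sum>j\<le>n. \<Sum>k\<le>n. \<alpha> j * \<beta> k *
      (poly ((d ^^ p) (\<eta> $ j)) t * poly ((d ^^ (n - p)) (\<eta> $ k)) (- t)))"
    unfolding sum_product by (simp add: mult_ac)
  also have "\<dots> = (\<Sum>j\<le>n. \<Sum>p\<le>n. \<Sum>k\<le>n. \<alpha> j * \<beta> k *
      (poly ((d ^^ p) (\<eta> $ j)) t * poly ((d ^^ (n - p)) (\<eta> $ k)) (- t)))"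
    by (rule sum.swap)
  also have "\<dots> = (\<Sum>j\<le>n. \<Sum>k\<le>n. \<Sum>p\<le>n. \<alpha> j * \<beta> k *
      (poly ((d ^^ p) (\<eta> $ j)) t * poly ((d ^^ (n - p)) (\<eta> $ k)) (- t)))"
    by (intro sum.cong refl sum.swap)
  also have "\<dots> = (\<Sum>j\<le>n. \<Sum>k\<le>n. \<alpha> j * \<beta> k *
      poly (umbral_pairing n d (\<eta> $ j) (dagger (\<eta> $ k))) t)"
    by (simp add: poly_umbral_pairing_dagger degree_eta sum_distrib_left)
  also have "\<dots> = (\<Sum>j\<le>n. \<Sum>k\<le>n. if k = n - j then \<alpha> j * \<beta> (n - j) * fact j * fact (n - j) else 0)"
    by (intro sum.cong refl) (auto simp: poly_umbral_pairing_eta)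
  also have "\<dots> = (\<Sum>j\<le>n. \<alpha> j * \<beta> (n - j) * fact j * fact (n - j))"
    by simp
  finally show ?thesis .
qed

section \<open>Curves in coordinates, their Wronskians and their duals\<close>

text \<open>The rows of \<open>M\<close> are the coordinates of the components in the binomial
  basis, and the right inverse \<open>N\<close> witnesses that \<open>M\<close> is invertible. Both
  are read only at indices up to n.\<close>

definition expansion ::
  "complex poly vec \<Rightarrow> (nat \<Rightarrow> nat \<Rightarrow> complex) \<Rightarrow> (nat \<Rightarrow> nat \<Rightarrow> complex) \<Rightarrow> bool" where
  "expansion \<theta> M N \<longleftrightarrow>
     \<theta> \<in> carrier_vec (n + 1) \<and>
     (\<forall>a\<le>n. \<theta> $ a = (\<Sum>j\<le>n. smult (M a j) (\<eta> $ j))) \<and>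
     (\<forall>a\<le>n. \<forall>l\<le>n. (\<Sum>j\<le>n. M a j * N j l) = (if a = l then 1 else 0))"

lemma expansion_carrier: "expansion \<theta> M N \<Longrightarrow> \<theta> \<in> carrier_vec (n + 1)"
  by (simp add: expansion_def)

lemma expansion_index:
  "expansion \<theta> M N \<Longrightarrow> a \<le> n \<Longrightarrow> \<theta> $ a = (\<Sum>j\<le>n. smult (M a j) (\<eta> $ j))"
  by (simp add: expansion_def)

lemma expansion_inverse:
  "expansion \<theta> M N \<Longrightarrow> a \<le> n \<Longrightarrow> l \<le> n \<Longrightarrow>
    (\<Sum>j\<le>n. M a j * N j l) = (if a = l then 1 else 0)"
  by (simp add: expansion_def)

text \<open>By \<open>funpow_d_eta\<close> the factorials cancel, and the sum over j becomes entry i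
  of (x \<star> \<eta>(-t)) \<star> \<eta>(t), that is x_i.\<close>

lemma expansion_coordinates:
  assumes exp: "expansion \<theta> M N" and a: "a \<le> n"
  shows "(\<Sum>j\<le>n. poly ((d ^^ j) (\<theta> $ a)) t * (binconv x (\<sigma> (- t)) j / fact j)) = (\<Sum>i\<le>n. M a i * x i)"
proof -
  have inner: "(\<Sum>j\<le>n. fact j * of_nat (i choose j) * \<sigma> t (i - j) * (binconv x (\<sigma> (- t)) j / fact j)) = x i"
    if i: "i \<le> n" for i
  proof -
    have "(\<Sum>j\<le>n. fact j * of_nat (i choose j) * \<sigma> t (i - j) * (binconv x (\<sigma> (- t)) j / fact j))
        = (\<Sum>j\<le>n. of_nat (i choose j) * binconv x (\<sigma> (- t)) j * \<sigma> t (i - j))"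
      by (rule sum.cong) auto
    also have "\<dots> = (\<Sum>j\<le>i. of_nat (i choose j) * binconv x (\<sigma> (- t)) j * \<sigma> t (i - j))"
      using i by (intro sum.mono_neutral_right) (auto simp: not_le)
    also have "\<dots> = binconv x (binconv (\<sigma> t) (\<sigma> (- t))) i"
      unfolding binconv_def[of "binconv x _", symmetric] binconv_assoc
      by (simp add: binconv_commute)
    also have "\<dots> = binconv x (\<lambda>k. if k = 0 then 1 else 0) i"
      using i by (intro binconv_cong) (auto simp: binconv_eta_minus)
    finally show ?thesis by (simp add: binconv_unit_right)
  qed
  have "(\<Sum>j\<le>n. poly ((d ^^ j) (\<theta> $ a)) t * (binconv x (\<sigma> (- t)) j / fact j))
      = (\<Sum>j\<le>n. \<Sum>i\<le>n. M a i * (fact j * of_nat (i choose j) * \<sigma> t (i - j) * (binconv x (\<sigma> (- t)) j / fact j)))"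
    using a
    by (intro sum.cong refl)
       (simp add: expansion_index[OF exp] funpow_d_eta_sum degree_eta funpow_d_eta poly_sum sum_distrib_left sum_divide_distrib \<sigma>_def mult_ac)
  also have "\<dots> = (\<Sum>i\<le>n. M a i * (\<Sum>j\<le>n. fact j * of_nat (i choose j) * \<sigma> t (i - j) * (binconv x (\<sigma> (- t)) j / fact j)))"
    unfolding sum_distrib_left by (rule sum.swap)
  also have "\<dots> = (\<Sum>i\<le>n. M a i * x i)"
    by (intro sum.cong refl) (simp only: inner atMost_iff)
  finally show ?thesis .
qed

lemma expansion_wronskian:
  assumes exp: "expansion \<theta> M N"
    and v: "v \<in> carrier_vec (n + 1)" "\<And>a. a \<le> n \<Longrightarrow> v $ a = (\<Sum>i\<le>n. M a i * x i)"
  shows "umbral_wronskian n d \<theta> t v = binconv x (\<sigma> t) n / fact n"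
proof -
  define D where "D = mat (n + 1) (n + 1) (\<lambda>(i, j). poly ((d ^^ j) (\<theta> $ i)) (- t))"
  define f where "f x j = binconv x (\<sigma> t) j / fact j" for x j
  define c where "c = vec (n + 1) (f x)"
  \<comment> \<open>Column l holds the coordinates of e_l, since e_l is \<open>M\<close> applied to
    column l of \<open>N\<close>. Thus \<open>C\<close> is a right inverse of \<open>D\<close>,
    which makes \<open>det D\<close> nonzero.\<close>
  define C where "C = mat (n + 1) (n + 1) (\<lambda>(j, l). f (\<lambda>i. N i l) j)"
  have coord: "(\<Sum>j\<in>{0..<Suc n}. poly ((d ^^ j) (\<theta> $ a)) (- t) * f x j) = (\<Sum>i\<le>n. M a i * x i)"
    if "a \<le> n" for a x
    using expansion_coordinates[OF exp that, of "- t" x]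
    by (simp add: f_def atLeast0LessThan lessThan_Suc_atMost del: sum.op_ivl_Suc)
  have "D * C = 1\<^sub>m (n + 1)"
    by (rule eq_matI)
       (simp_all add: D_def C_def scalar_prod_def coord expansion_inverse[OF exp] less_Suc_eq_le del: sum.op_ivl_Suc)
  then have "det D * det C = 1"
    using det_mult[of D "n + 1" C] by (simp add: D_def C_def)
  then have "det D \<noteq> 0" by auto
  moreover have "v = D *\<^sub>v c"
    using v by (intro eq_vecI)
      (simp_all add: D_def c_def scalar_prod_def coord less_Suc_eq_le del: sum.op_ivl_Suc)
  ultimately have "umbral_wronskian n d \<theta> (- (- t)) v = c $ n"
    by (intro umbral_wronskian_cramer[OF expansion_carrier[OF exp] _ D_def]) (auto simp: c_def)
  then show ?thesis by (simp add: c_def f_def)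
qed

text \<open>Since e_{n-b} is \<open>M\<close> applied to column n - b of \<open>N\<close>, its
  Wronskian is the last entry of that column convolved with \<eta>(t), divided by n!. The values at
  all points determine the polynomial chosen by \<open>THE\<close>.\<close>

lemma expansion_dual_index:
  assumes exp: "expansion \<theta> M N" and b: "b \<le> n"
  shows "dual_curve n d \<theta> $ b = (\<Sum>k\<le>n.
    smult (fact b * fact (n - b) / fact n * of_nat (n choose k) * N (n - k) (n - b)) (\<eta> $ k))"
    (is "_ = ?Q")
proof -
  let ?W = "\<lambda>t. fact b * fact (n - b) * umbral_wronskian n d \<theta> t (unit_vec (n + 1) (n - b))"
  have Q: "poly ?Q t = ?W t" for t
  proof -
    have "umbral_wronskian n d \<theta> t (unit_vec (n + 1) (n - b)) = binconv (\<lambda>i. N i (n - b)) (\<sigma> t) n / fact n"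
      by (rule expansion_wronskian[OF exp]) (auto simp: expansion_inverse[OF exp])
    then show ?thesis
      by (simp add: binconv_commute[of _ "\<sigma> t"] binconv_def poly_sum \<sigma>_def sum_distrib_left
          sum_divide_distrib mult_ac)
  qed
  have "dual_curve n d \<theta> $ b = (THE Q. \<forall>t. poly Q t = ?W t)"
    using b by (simp add: dual_curve_def)
  also have "\<dots> = ?Q"
    by (rule the_equality) (use Q in \<open>auto simp flip: poly_eq_poly_eq_iff\<close>)
  finally show ?thesis .
qed

lemma expansion_pairing_dual:
  assumes exp: "expansion \<theta> M N" and a: "a \<le> n" and b: "b \<le> n"
  shows "umbral_pairing n d (\<theta> $ a) (dagger (dual_curve n d \<theta> $ b))
    = [:if a + b = n then fact a * fact b else 0:]"
proof -
  have "poly (umbral_pairing n d (\<theta> $ a) (dagger (dual_curve n d \<theta> $ b))) t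
      = (if a + b = n then fact a * fact b else 0)" for t
  proof -
    have "poly (umbral_pairing n d (\<theta> $ a) (dagger (dual_curve n d \<theta> $ b))) t
       = (\<Sum>j\<le>n. M a j * (fact b * fact (n - b) / fact n * of_nat (n choose (n - j)) * N (n - (n - j)) (n - b))
            * fact j * fact (n - j))"
      by (rule poly_umbral_pairing_sums[OF expansion_index[OF exp a] expansion_dual_index[OF exp b]])
    \<comment> \<open>The binomial over n! cancels j! (n - j)!, which leaves an entry of the product
      of \<open>M\<close> and \<open>N\<close>.\<close>
    also have "\<dots> = (\<Sum>j\<le>n. fact b * fact (n - b) * (M a j * N j (n - b)))"
      by (intro sum.cong refl) (auto simp: binomial_fact)
    also have "\<dots> = fact b * fact (n - b) * (if a = n - b then 1 else 0)"
      using a by (simp add: expansion_inverse[OF exp] flip: sum_distrib_left)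
    finally show ?thesis
      using b by auto
  qed
  then show ?thesis
    by (simp flip: poly_eq_poly_eq_iff add: fun_eq_iff)
qed

text \<open>Both curves are graded bases, and \<open>M\<close>, \<open>N\<close> are the two
  transition matrices. Substituting one expansion into the other and comparing coefficients gives
  the inverse relation.\<close>

lemma vandermonde_expansion:
  assumes "vandermonde_curve n \<theta>"
  shows "\<exists>M N. expansion \<theta> M N"
proof -
  have \<theta>: "\<theta> \<in> carrier_vec (n + 1)" "\<And>k. k \<le> n \<Longrightarrow> degree (\<theta> $ k) = k \<and> \<theta> $ k \<noteq> 0"
    using assms by (auto simp: vandermonde_curve_def)
  have "\<exists>c. \<theta> $ a = (\<Sum>j\<le>n. smult (c j) (\<eta> $ j))" if "a \<le> n" for a
    using graded_family_spans[of n "($) \<eta>" "\<theta> $ a"] \<theta> degree_eta eta_nonzero that by auto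
  then obtain M where M: "\<And>a. a \<le> n \<Longrightarrow> \<theta> $ a = (\<Sum>j\<le>n. smult (M a j) (\<eta> $ j))"
    by metis
  have "\<exists>c. \<eta> $ a = (\<Sum>j\<le>n. smult (c j) (\<theta> $ j))" if "a \<le> n" for a
    using graded_family_spans[of n "($) \<theta>" "\<eta> $ a"] \<theta> degree_eta that by auto
  then obtain N where N: "\<And>a. a \<le> n \<Longrightarrow> \<eta> $ a = (\<Sum>l\<le>n. smult (N a l) (\<theta> $ l))"
    by metis
  have "(\<Sum>j\<le>n. M a j * N j l) = (if a = l then 1 else 0)" if a: "a \<le> n" and l: "l \<le> n" for a l
  proof -
    have "\<theta> $ a = (\<Sum>j\<le>n. \<Sum>l\<le>n. smult (M a j * N j l) (\<theta> $ l))"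
      unfolding M[OF a]
    proof (rule sum.cong[OF refl])
      fix j assume "j \<in> {..n}"
      then have "\<eta> $ j = (\<Sum>l\<le>n. smult (N j l) (\<theta> $ l))" by (intro N) simp
      then show "smult (M a j) (\<eta> $ j) = (\<Sum>l\<le>n. smult (M a j * N j l) (\<theta> $ l))"
        by (simp only: smult_sum_right smult_smult)
    qed
    also have "\<dots> = (\<Sum>l\<le>n. smult (\<Sum>j\<le>n. M a j * N j l) (\<theta> $ l))"
      unfolding smult_sum by (rule sum.swap)
    finally have 1: "\<theta> $ a = (\<Sum>l\<le>n. smult (\<Sum>j\<le>n. M a j * N j l) (\<theta> $ l))" .
    have "(\<Sum>l\<le>n. smult (if a = l then 1 else 0) (\<theta> $ l)) = (\<Sum>l\<le>n. if a = l then \<theta> $ l else 0)"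
      by (rule sum.cong) auto
    also have "\<dots> = \<theta> $ a" using a by simp
    finally have 2: "(\<Sum>l\<le>n. smult (if a = l then 1 else 0) (\<theta> $ l)) = \<theta> $ a" .
    have "(\<Sum>l\<le>n. smult ((\<Sum>j\<le>n. M a j * N j l) - (if a = l then 1 else 0)) (\<theta> $ l)) = 0"
      unfolding smult_diff_left sum_subtractf using 1 2 by simp
    from graded_family_independent[OF \<theta>(2) this l] show ?thesis by simp
  qed
  then show ?thesis
    using M \<theta>(1) unfolding expansion_def by blast
qed

text \<open>Here both matrices are the identity, so only k = b survives, with coefficient b! (n -
  b)! / n! times (n choose b), which is 1.\<close>

lemma dual_curve_eta: "dual_curve n d \<eta> = \<eta>"
proof -
  let ?I = "\<lambda>a j. if a = j then 1 else (0::complex)"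
  have exp: "expansion \<eta> ?I ?I"
    unfolding expansion_def
  proof (intro conjI allI impI)
    fix a assume "a \<le> n"
    have "(\<Sum>j\<le>n. smult (?I a j) (\<eta> $ j)) = (\<Sum>j\<le>n. if a = j then \<eta> $ j else 0)"
      by (rule sum.cong) auto
    then show "\<eta> $ a = (\<Sum>j\<le>n. smult (?I a j) (\<eta> $ j))"
      using \<open>a \<le> n\<close> by simp
  next
    fix a l assume "a \<le> n" "l \<le> n"
    have "(\<Sum>j\<le>n. ?I a j * ?I j l) = (\<Sum>j\<le>n. if a = j then ?I a l else 0)"
      by (rule sum.cong) auto
    then show "(\<Sum>j\<le>n. ?I a j * ?I j l) = ?I a l"
      using \<open>a \<le> n\<close> by simp
  qed (rule eta_carrier)
  show ?thesis
  proof (rule eq_vecI)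
    fix b assume "b < dim_vec \<eta>"
    then have b: "b \<le> n" using eta_carrier by auto
    have "dual_curve n d \<eta> $ b = (\<Sum>k\<le>n. if k = b then \<eta> $ b else 0)"
      unfolding expansion_dual_index[OF exp b]
      by (rule sum.cong) (use b in \<open>auto simp: binomial_fact\<close>)
    then show "dual_curve n d \<eta> $ b = \<eta> $ b" using b by simp
  qed (use eta_carrier in \<open>simp add: dual_curve_def\<close>)
qed

section \<open>Sheffer curves as convolutions\<close>

lemma const_curve_bconv_index:
  assumes "u \<in> carrier_vec (n + 1)" "a \<le> n"
  shows "(const_curve u \<star> \<eta>) $ a = (\<Sum>j\<le>n. smult (of_nat (a choose j) * u $ (a - j)) (\<eta> $ j))"
proof -
  have "(const_curve u \<star> \<eta>) $ a = (\<Sum>k\<le>a. smult (of_nat (a choose k) * u $ k) (\<eta> $ (a - k)))"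
    using assms by (simp add: bconv_def const_curve_def of_nat_poly)
  also have "\<dots> = (\<Sum>j\<le>a. smult (of_nat (a choose j) * u $ (a - j)) (\<eta> $ j))"
    by (rule sum.reindex_bij_witness[of _ "\<lambda>k. a - k" "\<lambda>k. a - k"])
       (auto simp: binomial_symmetric[symmetric])
  \<comment> \<open>The added terms have j > a and a zero binomial; the sum now has the range that
    \<open>expansion\<close> requires.\<close>
  also have "\<dots> = (\<Sum>j\<le>n. smult (of_nat (a choose j) * u $ (a - j)) (\<eta> $ j))"
    using assms(2) by (intro sum.mono_neutral_left) (auto simp: not_le)
  finally show ?thesis .
qed

lemma sum_binomial_matrix:
  assumes "a \<le> n"
  shows "(\<Sum>j\<le>n. of_nat (a choose j) * u (a - j) * x j) = binconv x u a"
proof -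
  have "(\<Sum>j\<le>n. of_nat (a choose j) * u (a - j) * x j) = (\<Sum>j\<le>a. of_nat (a choose j) * u (a - j) * x j)"
    using assms by (intro sum.mono_neutral_right) (auto simp: not_le)
  then show ?thesis
    by (simp add: binconv_flip)
qed

lemma sheffer_expansion:
  assumes u: "u \<in> carrier_vec (n + 1)" and w: "binconv w (($) u) = (\<lambda>k. if k = 0 then 1 else 0)"
  shows "expansion (const_curve u \<star> \<eta>)
    (\<lambda>a j. of_nat (a choose j) * u $ (a - j)) (\<lambda>a j. of_nat (a choose j) * w (a - j))"
  unfolding expansion_def
proof (intro conjI allI impI)
  show "const_curve u \<star> \<eta> \<in> carrier_vec (n + 1)"
    using u by (auto simp: bconv_def const_curve_def)
  show "(const_curve u \<star> \<eta>) $ a = (\<Sum>j\<le>n. smult (of_nat (a choose j) * u $ (a - j)) (\<eta> $ j))"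
    if "a \<le> n" for a
    using const_curve_bconv_index[OF u that] .
  \<comment> \<open>Column l of the second matrix is e_l \<star> w, so the product has column (e_l
    \<star> w) \<star> u = e_l.\<close>
  show "(\<Sum>j\<le>n. of_nat (a choose j) * u $ (a - j) * (of_nat (j choose l) * w (j - l)))
      = (if a = l then 1 else 0)" if "a \<le> n" for a l
    unfolding sum_binomial_matrix[OF that] binconv_delta[of l w, symmetric]
    by (simp add: binconv_assoc w binconv_unit_right)
qed

lemma sheffer_dual:
  assumes u: "u \<in> carrier_vec (n + 1)" "u $ 0 \<noteq> 0"
  shows "dual_curve n d (const_curve u \<star> \<eta>) = const_curve (bconv_inverse u) \<star> \<eta>"
proof -
  obtain w where w: "binconv (($) u) w = (\<lambda>k. if k = 0 then 1 else 0)"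
    using binconv_inverse_exists[of "($) u"] u(2) by blast
  have inv: "bconv_inverse u = vec (n + 1) w"
    using bconv_inverse_eq[OF u(1) w] .
  have exp: "expansion (const_curve u \<star> \<eta>)
      (\<lambda>a j. of_nat (a choose j) * u $ (a - j)) (\<lambda>a j. of_nat (a choose j) * w (a - j))"
    using u(1) w by (intro sheffer_expansion) (simp_all add: binconv_commute)
  show ?thesis
  proof (rule eq_vecI)
    fix b assume "b < dim_vec (const_curve (bconv_inverse u) \<star> \<eta>)"
    then have b: "b \<le> n" by (simp add: inv bconv_def const_curve_def)
    have rhs: "(const_curve (bconv_inverse u) \<star> \<eta>) $ b
        = (\<Sum>j\<le>n. smult (of_nat (b choose j) * w (b - j)) (\<eta> $ j))"
      using b by (simp add: inv const_curve_bconv_index)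
    show "dual_curve n d (const_curve u \<star> \<eta>) $ b = (const_curve (bconv_inverse u) \<star> \<eta>) $ b"
      unfolding expansion_dual_index[OF exp b] rhs
    proof (rule sum.cong[OF refl])
      fix k assume "k \<in> {..n}"
      then have k: "k \<le> n" by simp
      \<comment> \<open>For k at most b the factorials collapse to (b choose k); for k > b both (n -
        k choose n - b) and (b choose k) are zero.\<close>
      have "fact b * fact (n - b) / fact n * of_nat (n choose k) * (of_nat (n - k choose (n - b)) * w (n - k - (n - b)))
          = of_nat (b choose k) * w (b - k)"
      proof (cases "k \<le> b")
        case True
        have "n - k - (n - b) = b - k" using True b by simp
        then show ?thesis
          using True b k by (simp add: binomial_fact)
      next
        case False
        then have "n - k < n - b" "b < k" using b k by auto
        then show ?thesis by (simp add: binomial_eq_0)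
      qed
      then show "smult (fact b * fact (n - b) / fact n * of_nat (n choose k) *
            (of_nat (n - k choose (n - b)) * w (n - k - (n - b)))) (\<eta> $ k)
          = smult (of_nat (b choose k) * w (b - k)) (\<eta> $ k)"
        by simp
    qed
  qed (simp add: inv dual_curve_def bconv_def const_curve_def)
qed

text \<open>The point \<eta>(s) is \<open>M\<close> applied to \<eta>(s) \<star> w, so the Wronskian
  is governed by \<eta>(s) \<star> w \<star> \<eta>(t); the addition formula merges the two points
  into \<eta>(t + s) \<star> w.\<close>

lemma sheffer_wronskian:
  assumes u: "u \<in> carrier_vec (n + 1)" "u $ 0 \<noteq> 0"
  shows "fact n * umbral_wronskian n d (const_curve u \<star> \<eta>) t (curve_at \<eta> s)
    = poly (dual_curve n d (const_curve u \<star> \<eta>) $ n) (t + s)"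
proof -
  obtain w where w: "binconv (($) u) w = (\<lambda>k. if k = 0 then 1 else 0)"
    using binconv_inverse_exists[of "($) u"] u(2) by blast
  have w': "binconv w (($) u) = (\<lambda>k. if k = 0 then 1 else 0)"
    using w by (simp add: binconv_commute)
  have "umbral_wronskian n d (const_curve u \<star> \<eta>) t (curve_at \<eta> s)
      = binconv (binconv (\<sigma> s) w) (\<sigma> t) n / fact n"
  proof (rule expansion_wronskian[OF sheffer_expansion[OF u(1) w']])
    show "curve_at \<eta> s \<in> carrier_vec (n + 1)"
      using eta_carrier by (simp add: curve_at_def)
    show "curve_at \<eta> s $ a = (\<Sum>i\<le>n. of_nat (a choose i) * u $ (a - i) * binconv (\<sigma> s) w i)"
      if "a \<le> n" for a
      unfolding sum_binomial_matrix[OF that]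
      using that eta_carrier by (simp add: binconv_assoc w' binconv_unit_right curve_at_def \<sigma>_def)
  qed
  also have "binconv (binconv (\<sigma> s) w) (\<sigma> t) = binconv (binconv (\<sigma> t) (\<sigma> s)) w"
    by (metis binconv_assoc binconv_commute)
  also have "\<dots> n = binconv (\<sigma> (t + s)) w n"
    by (intro binconv_cong) (auto simp: binconv_eta)
  also have "\<dots> = poly (dual_curve n d (const_curve u \<star> \<eta>) $ n) (t + s)"
    by (simp add: sheffer_dual[OF u] bconv_inverse_eq[OF u(1) w] const_curve_bconv_index
        poly_sum binconv_def \<sigma>_def mult_ac)
  finally show ?thesis
    by simp
qed

end

theorem theorem1p1:
  fixes n :: nat and d :: "complex poly \<Rightarrow> complex poly" and \<eta> :: "complex poly vec"
  assumes "n \<ge> 1" and "delta_operator n d" and "binomial_curve n d \<eta>"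
  shows
    "(\<forall>a\<le>n. \<forall>b\<le>n. umbral_pairing n d (\<eta> $ a) (dagger (\<eta> $ b)) =
        [:if a + b = n then fact a * fact b else 0:]) \<and>
     (\<forall>\<theta>. vandermonde_curve n \<theta> \<longrightarrow>
        (\<forall>a\<le>n. \<forall>b\<le>n. umbral_pairing n d (\<theta> $ a) (dagger (dual_curve n d \<theta> $ b)) =
           [:if a + b = n then fact a * fact b else 0:])) \<and>
     dual_curve n d \<eta> = \<eta> \<and>
     (\<forall>\<theta> u. sheffer_curve n d \<theta> \<and> u \<in> carrier_vec (n + 1) \<and> u $ 0 \<noteq> 0 \<and>
        \<theta> = const_curve u \<star> \<eta> \<longrightarrow>
        dual_curve n d \<theta> = const_curve (bconv_inverse u) \<star> \<eta> \<and>
        (\<forall>s t. fact n * umbral_wronskian n d \<theta> t (curve_at \<eta> s) =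
           poly (dual_curve n d \<theta> $ n) (t + s)))"
proof -
  have "umbral_pairing n d (\<theta> $ a) (dagger (dual_curve n d \<theta> $ b))
      = [:if a + b = n then fact a * fact b else 0:]"
    if "vandermonde_curve n \<theta>" "a \<le> n" "b \<le> n" for \<theta> a b
    using vandermonde_expansion[OF assms that(1)] expansion_pairing_dual[OF assms _ that(2,3)] by blast
  then show ?thesis
    using umbral_pairing_eta[OF assms] dual_curve_eta[OF assms] sheffer_dual[OF assms] sheffer_wronskian[OF assms] by blast
qed

end
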